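(* Consider the problem $\min_{x,s} f(x)$ subject to $Ax+s=b$, $s\in\mathcal C$, where $f:\mathbb R^n\to\mathbb R$ is closed, convex and proper, $\mathcal C\subseteq\mathbb R^m$ is a nonempty closed convex set, $A\in\mathbb R^{m\times n}$ and $b\in\mathbb R^m$. Let $$r_0(x,s):=\tfrac12\big(|Ax+s-b|^2+\operatorname{dist}(s,\mathcal C)^2\big),\quad r(x,s,t):=\tfrac12\max\{f(x)-t,0\}^2+r_0(x,s),\quad r^\star(t):=\min_{x,s} r(x,s,t),$$ and let $t^\star:=\min\{t\in\mathbb R : 0\in\partial r^\star(t)\}$. Then the following statements are true. (1) $r^\star$ is closed, convex and proper, for every closed, convex and proper $f$ and every closed convex $\mathcal C$. (2) If the problem is feasible, then $r^\star$ is strictly decreasing for all $t\le t^\star$, and $r^\star(t)=0$ for all $t\ge t^\star$. (3) If the problem is infeasible, then $M:=\min_{x,s}r_0(x,s)>0$ and $\lim_{t\to\infty}r^\star(t)=M$. Moreover, there exists $\tau\in\mathbb R$ such that $\partial r^\star(t)=\{0\}$ and $r^\star(t)=M$ for all $t\ge\tau$, and $r^\star$ is strictly decreasing for all $t\le\tau$. (4) If the problem is unbounded, then $r^\star(t)=0$ for all $t\in\mathbb R$.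
   Context: $|\cdot|$ is the Euclidean norm, $\operatorname{dist}(s,\mathcal C):=\inf_{y\in\mathcal C}|s-y|$, and $\partial$ denotes the convex subdifferential. The variables are $x\in\mathbb R^n$, $s\in\mathbb R^m$, $t\in\mathbb R$. The problem is feasible if some $(x,s)$ satisfies $Ax+s=b$, $s\in\mathcal C$, and infeasible otherwise; it is unbounded if $f$ is unbounded below over the feasible points $(x,s)$. "$r^\star$ is strictly decreasing for all $t\le c$" means strictly decreasing on $(-\infty,c]$. The function $r^\star:\mathbb R\to[0,\infty)$ is called the value function.
   Formalization: Minima defining r* and M are read as infima, and t* may be −∞; in (3), M>0 and the "moreover" part assume that r_0 attains its minimum, and τ is claimed only if t* is not −∞ (otherwise r*=M and ∂r*={0} for all t), since (3) fails without these. *)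

theory Defs
  imports "HOL-Analysis.Analysis"
begin

definition proper_fun :: "('a \<Rightarrow> ereal) \<Rightarrow> bool" where
  "proper_fun F \<longleftrightarrow> (\<forall>x. F x \<noteq> -\<infinity>) \<and> (\<exists>x. F x \<noteq> \<infinity>)"

(* For real-valued f, properness is automatic, and so is closedness of a convex f
   on a Euclidean space; all three conditions are nevertheless spelled out. *)
definition closed_convex_proper :: "('a::euclidean_space \<Rightarrow> real) \<Rightarrow> bool" where
  "closed_convex_proper f \<longleftrightarrow>
     closed (epigraph UNIV f) \<and> convex_on UNIV f \<and> proper_fun (\<lambda>x. ereal (f x))"

definition subdifferential :: "('a::real_inner \<Rightarrow> real) \<Rightarrow> 'a \<Rightarrow> 'a set" where
  "subdifferential h x = {g. \<forall>y. h x + g \<bullet> (y - x) \<le> h y}"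

definition feasible_set ::
  "(real^'m) set \<Rightarrow> real^'n^'m \<Rightarrow> real^'m \<Rightarrow> ((real^'n) \<times> (real^'m)) set" where
  "feasible_set C A b = {(x, s). A *v x + s = b \<and> s \<in> C}"

definition feasible :: "(real^'m) set \<Rightarrow> real^'n^'m \<Rightarrow> real^'m \<Rightarrow> bool" where
  "feasible C A b \<longleftrightarrow> feasible_set C A b \<noteq> {}"

definition unbounded ::
  "(real^'n \<Rightarrow> real) \<Rightarrow> (real^'m) set \<Rightarrow> real^'n^'m \<Rightarrow> real^'m \<Rightarrow> bool" where
  "unbounded f C A b \<longleftrightarrow> \<not> bdd_below ((\<lambda>(x, s). f x) ` feasible_set C A b)"

definition r0 ::
  "(real^'m) set \<Rightarrow> real^'n^'m \<Rightarrow> real^'m \<Rightarrow> real^'n \<Rightarrow> real^'m \<Rightarrow> real" where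
  "r0 C A b x s = 1/2 * ((norm (A *v x + s - b))\<^sup>2 + (infdist s C)\<^sup>2)"

definition r ::
  "(real^'n \<Rightarrow> real) \<Rightarrow> (real^'m) set \<Rightarrow> real^'n^'m \<Rightarrow> real^'m
    \<Rightarrow> real^'n \<Rightarrow> real^'m \<Rightarrow> real \<Rightarrow> real" where
  "r f C A b x s t = 1/2 * (max (f x - t) 0)\<^sup>2 + r0 C A b x s"

(* The minimum over (x, s) need not be attained (e.g. f = exp in dimension one), so
   rstar and min_r0 are infima; where the minimum exists they equal it.
   Both families are bounded below by 0, so the real infima are meaningful. *)
definition rstar ::
  "(real^'n \<Rightarrow> real) \<Rightarrow> (real^'m) set \<Rightarrow> real^'n^'m \<Rightarrow> real^'m \<Rightarrow> real \<Rightarrow> real" where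
  "rstar f C A b t = (INF (x, s). r f C A b x s t)"

definition min_r0 :: "(real^'m) set \<Rightarrow> real^'n^'m \<Rightarrow> real^'m \<Rightarrow> real" where
  "min_r0 C A b = (INF (x, s). r0 C A b x s)"

definition r0_attains_min :: "(real^'m) set \<Rightarrow> real^'n^'m \<Rightarrow> real^'m \<Rightarrow> bool" where
  "r0_attains_min C A b \<longleftrightarrow> (\<exists>x s. \<forall>x' s'. r0 C A b x s \<le> r0 C A b x' s')"

definition stationary_levels ::
  "(real^'n \<Rightarrow> real) \<Rightarrow> (real^'m) set \<Rightarrow> real^'n^'m \<Rightarrow> real^'m \<Rightarrow> real set" where
  "stationary_levels f C A b = {t. 0 \<in> subdifferential (rstar f C A b) t}"

(* Extended-real, because the minimum does not exist when every t is stationary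
   (value -\<infinity>; in particular for unbounded problems) or when no t is (value \<infinity>). *)
definition tstar ::
  "(real^'n \<Rightarrow> real) \<Rightarrow> (real^'m) set \<Rightarrow> real^'n^'m \<Rightarrow> real^'m \<Rightarrow> ereal" where
  "tstar f C A b = Inf (ereal ` stationary_levels f C A b)"

end

theory Submission
  imports Defs
begin

text \<open>
  The minimal value of \<open>r\<^sup>\<star>\<close> is \<open>M = inf r\<^sub>0\<close>, its limit at infinity, so stationarity of \<open>t\<close> just means
  \<open>r\<^sup>\<star>(t) = M\<close>. Convexity of \<open>r\<^sup>\<star>\<close> (a partial infimum of a jointly convex function) makes the set of
  these \<open>t\<close> closed and forces strict decrease to the left of it.
  A near-minimiser of \<open>r(\<cdot>,\<cdot>,t)\<close> with \<open>r\<^sup>\<star>(t) = M\<close> has \<open>max {f(x) - t, 0}\<close> near \<open>0\<close>, hence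
  \<open>r\<^sup>\<star>(t - d) \<le> M + d\<^sup>2/2\<close>: there is no kink at the left end of the minimising set.
\<close>

section \<open>Convexity of partial infima, distances and squares; convex functions on the
  line\<close>

lemma convex_on_partial_INF:
  fixes F :: "'a::real_vector \<times> 'b::real_vector \<Rightarrow> real"
  assumes F: "convex_on (S \<times> T) F" and S: "S \<noteq> {}"
    and bdd: "\<And>y. y \<in> T \<Longrightarrow> bdd_below ((\<lambda>x. F (x, y)) ` S)"
  shows "convex_on T (\<lambda>y. INF x\<in>S. F (x, y))"
proof
  have ST: "convex (S \<times> T)"
    using F by (rule convex_on_imp_convex)
  then have "convex (snd ` (S \<times> T))"
    by (intro convex_linear_image linear_snd)
  then show T: "convex T"
    using S by (auto simp: snd_image_times split: if_splits)
  fix u :: real and y z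
  assume u: "0 < u" "u < 1" and yz: "y \<in> T" "z \<in> T"
  let ?w = "(1 - u) *\<^sub>R y + u *\<^sub>R z"
  let ?G = "\<lambda>y. INF x\<in>S. F (x, y)"
  show "?G ?w \<le> (1 - u) * ?G y + u * ?G z"
  proof (rule field_le_epsilon)
    fix e :: real
    assume "0 < e"
    then have "?G y < ?G y + e" "?G z < ?G z + e"
      by auto
    \<comment> \<open>The infima need not be attained, so \<open>p\<close> and \<open>q\<close> are
      minimisers only up to \<open>e\<close>. Their convex combination competes for the infimum at
      \<open>?w\<close>, and joint convexity bounds its value with total error
      \<open>e\<close>.\<close>
    then obtain p q where pq: "p \<in> S" "F (p, y) < ?G y + e" "q \<in> S" "F (q, z) < ?G z + e"
      using cINF_less_iff[OF S bdd] yz by meson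
    let ?x = "(1 - u) *\<^sub>R p + u *\<^sub>R q"
    have "(1 - u) *\<^sub>R (p, y) + u *\<^sub>R (q, z) \<in> S \<times> T"
      using u pq yz by (intro convexD[OF ST]) auto
    then have "?x \<in> S" "?w \<in> T"
      by auto
    then have "?G ?w \<le> F (?x, ?w)"
      by (intro cINF_lower bdd)
    also have "\<dots> = F ((1 - u) *\<^sub>R (p, y) + u *\<^sub>R (q, z))"
      by simp
    also have "\<dots> \<le> (1 - u) * F (p, y) + u * F (q, z)"
      using u pq yz by (intro convex_onD[OF F]) auto
    also have "\<dots> \<le> (1 - u) * (?G y + e) + u * (?G z + e)"
      using u pq by (intro add_mono mult_left_mono) auto
    also have "\<dots> = (1 - u) * ?G y + u * ?G z + e"
      by (simp add: algebra_simps)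
    finally show "?G ?w \<le> (1 - u) * ?G y + u * ?G z + e" .
  qed
qed

text \<open>The distance from \<open>x\<close> is the partial infimum over \<open>a\<close> in
  \<open>C\<close> of the jointly convex function \<open>dist x a\<close>.\<close>

lemma convex_on_infdist:
  fixes C :: "'a::real_normed_vector set"
  assumes "convex C" "C \<noteq> {}"
  shows "convex_on UNIV (\<lambda>x. infdist x C)"
proof -
  have "convex_on (C \<times> UNIV) (\<lambda>p::'a \<times> 'a. dist (snd p) (fst p))"
  proof
    fix u :: real and p q :: "'a \<times> 'a"
    assume u: "0 < u" "u < 1"
    have "snd ((1 - u) *\<^sub>R p + u *\<^sub>R q) - fst ((1 - u) *\<^sub>R p + u *\<^sub>R q)
        = (1 - u) *\<^sub>R (snd p - fst p) + u *\<^sub>R (snd q - fst q)"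
      by (simp add: algebra_simps)
    also have "norm \<dots> \<le> (1 - u) * norm (snd p - fst p) + u * norm (snd q - fst q)"
      using u by (intro order_trans[OF norm_triangle_ineq]) simp
    finally show "dist (snd ((1 - u) *\<^sub>R p + u *\<^sub>R q)) (fst ((1 - u) *\<^sub>R p + u *\<^sub>R q))
        \<le> (1 - u) * dist (snd p) (fst p) + u * dist (snd q) (fst q)"
      by (simp only: dist_norm)
  qed (use assms in \<open>auto intro: convex_Times\<close>)
  then have "convex_on UNIV (\<lambda>x. INF a\<in>C. dist (snd (a, x)) (fst (a, x)))"
    by (rule convex_on_partial_INF) (auto simp: assms intro!: bdd_belowI2[where m = 0])
  then show ?thesis
    using assms by (simp add: infdist_notempty)
qed

text \<open>Squaring is monotone only on nonnegative reals: the sign condition on \<open>g\<close>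
  allows its convexity inequality to be squared, after which convexity of the square itself
  finishes.\<close>

lemma convex_on_power2_of_nonneg:
  assumes g: "convex_on S g" and nonneg: "\<And>x. x \<in> S \<Longrightarrow> 0 \<le> g x"
  shows "convex_on S (\<lambda>x. (g x)\<^sup>2)"
proof
  show S: "convex S"
    using g by (rule convex_on_imp_convex)
  fix u :: real and x y
  assume u: "0 < u" "u < 1" and xy: "x \<in> S" "y \<in> S"
  then have "(1 - u) *\<^sub>R x + u *\<^sub>R y \<in> S"
    by (intro convexD[OF S]) auto
  then have "(g ((1 - u) *\<^sub>R x + u *\<^sub>R y))\<^sup>2 \<le> ((1 - u) * g x + u * g y)\<^sup>2"
    using u xy by (intro power_mono nonneg convex_onD[OF g]) auto
  also have "\<dots> \<le> (1 - u) * (g x)\<^sup>2 + u * (g y)\<^sup>2"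
    using convex_onD[OF convex_power2, of u "g x" "g y"] u by simp
  finally show "(g ((1 - u) *\<^sub>R x + u *\<^sub>R y))\<^sup>2 \<le> (1 - u) * (g x)\<^sup>2 + u * (g y)\<^sup>2" .
qed

text \<open>For \<open>s < t \<le> c\<close>, the point \<open>t\<close> is a convex combination of
  \<open>s\<close> and \<open>c\<close> whose weight \<open>u\<close> on \<open>c\<close> is
  positive; the strictly smaller value at \<open>c\<close> makes the convexity bound strict.\<close>

lemma strict_antimono_on_convex_until_min:
  fixes g :: "real \<Rightarrow> real"
  assumes g: "convex_on UNIV g" and lt: "\<And>t. t < c \<Longrightarrow> g c < g t"
  shows "strict_antimono_on {..c} g"
proof (rule monotone_onI)
  fix s t
  assume "s \<in> {..c}" "t \<in> {..c}" "s < t"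
  then have st: "s < t" "t \<le> c"
    by auto
  define u where "u = (t - s) / (c - s)"
  have u: "0 < u" "u \<le> 1"
    using st by (auto simp: u_def field_simps)
  have "(1 - u) *\<^sub>R s + u *\<^sub>R c = s + u * (c - s)"
    by (simp add: algebra_simps)
  also have "\<dots> = t"
    using st by (simp add: u_def)
  finally have "g t \<le> (1 - u) * g s + u * g c"
    using convex_onD[OF g, of u s c] u by simp
  also have "\<dots> < (1 - u) * g s + u * g s"
    using u lt[of s] st by simp
  finally show "g t < g s"
    by (simp add: algebra_simps)
qed

section \<open>Bounds, monotonicity and limit of the value function\<close>

context
  fixes f :: "real^'n \<Rightarrow> real"
    and C :: "(real^'m) set"
    and A :: "real^'n^'m"
    and b :: "real^'m"
begin

lemma r0_nonneg: "0 \<le> r0 C A b x s"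
  by (simp add: r0_def)

lemma r0_le_r: "r0 C A b x s \<le> r f C A b x s t"
  by (simp add: r_def)

lemma bdd_below_r0: "bdd_below (range (\<lambda>(x, s). r0 C A b x s))"
  by (rule bdd_belowI[where m = 0]) (auto simp: r0_nonneg)

lemma bdd_below_r: "bdd_below (range (\<lambda>(x, s). r f C A b x s t))"
  by (rule bdd_belowI[where m = 0]) (auto intro: order_trans[OF r0_nonneg r0_le_r])

lemma min_r0_le: "min_r0 C A b \<le> r0 C A b x s"
  unfolding min_r0_def using cINF_lower[OF bdd_below_r0, of "(x, s)"] by simp

lemma rstar_le: "rstar f C A b t \<le> r f C A b x s t"
  unfolding rstar_def using cINF_lower[OF bdd_below_r, of "(x, s)"] by simp

lemma min_r0_le_rstar: "min_r0 C A b \<le> rstar f C A b t"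
  unfolding rstar_def by (rule cINF_greatest) (auto intro: order_trans[OF min_r0_le r0_le_r])

lemma min_r0_nonneg: "0 \<le> min_r0 C A b"
  unfolding min_r0_def by (rule cINF_greatest) (auto simp: r0_nonneg)

text \<open>At a level not below \<open>f x\<close> the penalty term vanishes. This is the source of
  upper bounds for \<open>rstar\<close> in the limit, at minimisers of \<open>r0\<close> and in the
  unbounded case.\<close>

lemma rstar_le_r0: "f x \<le> t \<Longrightarrow> rstar f C A b t \<le> r0 C A b x s"
  using rstar_le[of t x s] by (simp add: r_def max_def split: if_splits)

lemma rstar_lessE:
  assumes "rstar f C A b t < a"
  obtains x s where "r f C A b x s t < a"
  using assms cINF_less_iff[OF _ bdd_below_r, of t a] unfolding rstar_def by auto

lemma min_r0_lessE:
  assumes "min_r0 C A b < a"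
  obtains x s where "r0 C A b x s < a"
  using assms cINF_less_iff[OF _ bdd_below_r0, of a] unfolding min_r0_def by auto

lemma antimono_rstar: "antimono (rstar f C A b)"
proof (rule antimonoI)
  fix t t' :: real
  assume "t \<le> t'"
  then have "r f C A b x s t' \<le> r f C A b x s t" for x s
    unfolding r_def by (intro add_mono mult_left_mono power_mono) auto
  then show "rstar f C A b t' \<le> rstar f C A b t"
    unfolding rstar_def[of _ _ _ _ t]
    by (intro cINF_greatest) (auto intro: order_trans[OF rstar_le])
qed

text \<open>From below, \<open>min_r0\<close> bounds every value. From above, a pair with
  \<open>r0\<close> below \<open>a\<close> has finite \<open>f x\<close>, and from that level on its
  penalty is zero.\<close>

lemma tendsto_rstar: "(rstar f C A b \<longlongrightarrow> min_r0 C A b) at_top"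
proof (rule order_tendstoI)
  fix a
  assume "a < min_r0 C A b"
  then show "\<forall>\<^sub>F t in at_top. a < rstar f C A b t"
    by (intro always_eventually allI less_le_trans[OF _ min_r0_le_rstar])
next
  fix a
  assume "min_r0 C A b < a"
  then obtain x s where "r0 C A b x s < a"
    by (rule min_r0_lessE)
  then have "\<forall>t\<ge>f x. rstar f C A b t < a"
    by (auto intro: le_less_trans[OF rstar_le_r0])
  then show "\<forall>\<^sub>F t in at_top. rstar f C A b t < a"
    unfolding eventually_at_top_linorder by blast
qed

section \<open>Stationary levels and the subdifferential at the minimum\<close>

lemma stationary_iff: "t \<in> stationary_levels f C A b \<longleftrightarrow> rstar f C A b t = min_r0 C A b"
proof
  assume "t \<in> stationary_levels f C A b"
  then have "rstar f C A b t \<le> rstar f C A b y" for y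
    by (auto simp: stationary_levels_def subdifferential_def)
  \<comment> \<open>The global-minimum inequality is passed to the limit at infinity, which equals
    \<open>min_r0\<close>.\<close>
  then have "rstar f C A b t \<le> min_r0 C A b"
    by (intro tendsto_lowerbound[OF tendsto_rstar]) auto
  with min_r0_le_rstar show "rstar f C A b t = min_r0 C A b"
    by (intro antisym)
next
  assume "rstar f C A b t = min_r0 C A b"
  then show "t \<in> stationary_levels f C A b"
    by (auto simp: stationary_levels_def subdifferential_def min_r0_le_rstar)
qed

lemma rstar_left_of_min:
  assumes t: "rstar f C A b t = min_r0 C A b" and d: "0 \<le> d"
  shows "rstar f C A b (t - d) \<le> min_r0 C A b + d\<^sup>2 / 2"
proof -
  have bound: "rstar f C A b (t - d) \<le> min_r0 C A b + e\<^sup>2 / 2 + (e + d)\<^sup>2 / 2" if "0 < e" for e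
  proof -
    \<comment> \<open>The slack \<open>e\<^sup>2 / 2\<close> is chosen to match the penalty: as the
      \<open>r0\<close> part is already at least \<open>min_r0\<close>, the near-minimiser satisfies
      \<open>f x - t \<le> e\<close>. Lowering the level by \<open>d\<close> then costs at most
      \<open>(e + d)\<^sup>2 / 2\<close>, and \<open>e\<close> tends to 0 at the end.\<close>
    have "rstar f C A b t < min_r0 C A b + e\<^sup>2 / 2"
      using t that by simp
    then obtain x s where xs: "r f C A b x s t < min_r0 C A b + e\<^sup>2 / 2"
      by (rule rstar_lessE)
    then have r0: "r0 C A b x s < min_r0 C A b + e\<^sup>2 / 2"
      using r0_le_r[of x s t] by simp
    have "(max (f x - t) 0)\<^sup>2 \<le> e\<^sup>2"
      using xs min_r0_le[of x s] by (simp add: r_def)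
    then have "max (f x - t) 0 \<le> e"
      by (rule power2_le_imp_le) (use that in simp)
    then have "max (f x - (t - d)) 0 \<le> e + d"
      using d that by auto
    then have "(max (f x - (t - d)) 0)\<^sup>2 \<le> (e + d)\<^sup>2"
      by (intro power_mono) auto
    then show ?thesis
      using rstar_le[of "t - d" x s] r0 by (simp add: r_def)
  qed
  have "((\<lambda>e. min_r0 C A b + e\<^sup>2 / 2 + (e + d)\<^sup>2 / 2)
      \<longlongrightarrow> min_r0 C A b + 0\<^sup>2 / 2 + (0 + d)\<^sup>2 / 2) (at_right 0)"
    by (intro tendsto_intros) auto
  then have "rstar f C A b (t - d) \<le> min_r0 C A b + 0\<^sup>2 / 2 + (0 + d)\<^sup>2 / 2"
    by (rule tendsto_lowerbound)
      (auto simp: eventually_at_right_less bound intro!: eventually_at_rightI[of 0 1])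
  then show ?thesis
    by simp
qed

text \<open>A positive subgradient would contradict monotonicity to the right, a negative one the
  quadratic growth bound to the left.\<close>

lemma subdifferential_rstar_at_min:
  assumes t: "rstar f C A b t = min_r0 C A b"
  shows "subdifferential (rstar f C A b) t = {0}"
proof (intro equalityI subsetI)
  fix p
  assume "p \<in> subdifferential (rstar f C A b) t"
  then have p: "min_r0 C A b + p * (y - t) \<le> rstar f C A b y" for y
    using t by (auto simp: subdifferential_def)
  have "rstar f C A b (t + 1) \<le> rstar f C A b t"
    by (intro antimonoD[OF antimono_rstar]) simp
  then have "p \<le> 0"
    using p[of "t + 1"] t by simp
  have "- p \<le> 0 + e" if "0 < e" for e
  proof -
    \<comment> \<open>A step of length \<open>2 * e\<close> to the left costs at most
      \<open>(2 * e)\<^sup>2 / 2 = e * (2 * e)\<close>, so dividing by \<open>2 * e\<close> leaves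
      exactly \<open>e\<close>.\<close>
    have "- p * (2 * e) \<le> e * (2 * e)"
      using p[of "t - 2 * e"] rstar_left_of_min[OF t, of "2 * e"] that
      by (simp add: power2_eq_square algebra_simps)
    then have "- p \<le> e"
      by (rule mult_right_le_imp_le) (use that in simp)
    then show ?thesis
      by simp
  qed
  then have "- p \<le> 0"
    by (rule field_le_epsilon)
  with \<open>p \<le> 0\<close> show "p \<in> {0}"
    by simp
next
  fix p :: real
  assume "p \<in> {0}"
  then show "p \<in> subdifferential (rstar f C A b) t"
    using t stationary_iff[of t] by (simp add: stationary_levels_def)
qed

section \<open>Feasible, infeasible and unbounded problems\<close>

lemma min_r0_eq_0_of_feasible:
  assumes "feasible C A b"
  shows "min_r0 C A b = 0"
proof -
  obtain x s where "A *v x + s = b" "s \<in> C"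
    using assms by (auto simp: feasible_def feasible_set_def)
  then show ?thesis
    using min_r0_le[of x s] min_r0_nonneg by (simp add: r0_def)
qed

text \<open>At an actual minimiser one of the two residuals is nonzero, closedness turning
  \<open>s \<notin> C\<close> into positive distance. A bare infimum could be 0 although no pair is
  feasible.\<close>

lemma min_r0_pos_of_infeasible:
  assumes "\<not> feasible C A b" "r0_attains_min C A b" "C \<noteq> {}" "closed C"
  shows "0 < min_r0 C A b"
proof -
  obtain x s where le: "r0 C A b x s \<le> r0 C A b x' s'" for x' s'
    using assms by (auto simp: r0_attains_min_def)
  have "A *v x + s \<noteq> b \<or> s \<notin> C"
    using assms by (auto simp: feasible_def feasible_set_def)
  then have "A *v x + s - b \<noteq> 0 \<or> infdist s C \<noteq> 0"
    using in_closed_iff_infdist_zero[of C s] assms by simp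
  then have "0 < r0 C A b x s"
    by (auto simp: r0_def intro: add_pos_nonneg add_nonneg_pos)
  also have "r0 C A b x s \<le> min_r0 C A b"
    unfolding min_r0_def by (rule cINF_greatest) (auto simp: le)
  finally show ?thesis .
qed

text \<open>Below every level there is a feasible pair, at which both the penalty and
  \<open>r0\<close> vanish.\<close>

lemma rstar_eq_0_of_unbounded:
  assumes "unbounded f C A b"
  shows "rstar f C A b t = 0"
proof -
  have "\<not> (\<forall>p\<in>feasible_set C A b. t \<le> (\<lambda>(x, s). f x) p)"
    using assms unfolding unbounded_def by (meson bdd_belowI2)
  then obtain x s where xs: "A *v x + s = b" "s \<in> C" "f x < t"
    by (auto simp: feasible_set_def not_le)
  then have "rstar f C A b t \<le> r0 C A b x s"
    by (intro rstar_le_r0) simp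
  also have "r0 C A b x s = 0"
    using xs by (simp add: r0_def)
  finally show ?thesis
    using min_r0_nonneg min_r0_le_rstar[of t] by simp
qed

text \<open>Provides the nonemptiness of the stationary set: at level \<open>f x\<close> the
  minimiser pays no penalty.\<close>

lemma stationary_of_r0_minimiser:
  assumes "\<And>x' s'. r0 C A b x s \<le> r0 C A b x' s'"
  shows "f x \<in> stationary_levels f C A b"
proof -
  have "rstar f C A b (f x) \<le> r0 C A b x s"
    by (rule rstar_le_r0) simp
  also have "r0 C A b x s \<le> min_r0 C A b"
    unfolding min_r0_def by (rule cINF_greatest) (auto simp: assms)
  finally show ?thesis
    using min_r0_le_rstar[of "f x"] by (simp add: stationary_iff)
qed

lemma r0_attains_min_of_feasible:
  assumes "feasible C A b"
  shows "r0_attains_min C A b"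
proof -
  obtain x s where "A *v x + s = b" "s \<in> C"
    using assms by (auto simp: feasible_def feasible_set_def)
  then have "r0 C A b x s \<le> r0 C A b x' s'" for x' s'
    using r0_nonneg[of x' s'] by (simp add: r0_def)
  then show ?thesis
    by (auto simp: r0_attains_min_def)
qed

section \<open>Convexity of the value function and the shape of its stationary set\<close>

context
  assumes f: "convex_on UNIV f" and C: "convex C" "C \<noteq> {}"
begin

text \<open>Convexity must be joint in \<open>(x, s)\<close> and \<open>t\<close> for the partial
  infimum to inherit it. Each squared quantity is convex and nonnegative: a positive part, the norm
  of an affine map, and a distance.\<close>

lemma convex_on_r: "convex_on UNIV (\<lambda>((x, s), t). r f C A b x s t)"
proof -
  have "convex_on UNIV (\<lambda>p :: ((real^'n) \<times> (real^'m)) \<times> real. max (f (fst (fst p)) - snd p) 0)"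
  proof
    fix u :: real and p q :: "((real^'n) \<times> (real^'m)) \<times> real"
    assume u: "0 < u" "u < 1"
    let ?w = "(1 - u) *\<^sub>R p + u *\<^sub>R q"
    let ?h = "\<lambda>p :: ((real^'n) \<times> (real^'m)) \<times> real. f (fst (fst p)) - snd p"
    have "f (fst (fst ?w)) \<le> (1 - u) * f (fst (fst p)) + u * f (fst (fst q))"
      using convex_onD[OF f, of u "fst (fst p)" "fst (fst q)"] u by simp
    then have "?h ?w \<le> (1 - u) * ?h p + u * ?h q"
      by (simp add: algebra_simps)
    also have "\<dots> \<le> (1 - u) * max (?h p) 0 + u * max (?h q) 0"
      using u by (intro add_mono mult_left_mono) auto
    finally show "max (?h ?w) 0 \<le> (1 - u) * max (?h p) 0 + u * max (?h q) 0"
      using u by simp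
  qed simp
  moreover have "convex_on UNIV
      (\<lambda>p :: ((real^'n) \<times> (real^'m)) \<times> real. norm (A *v fst (fst p) + snd (fst p) - b))"
  proof
    fix u :: real and p q :: "((real^'n) \<times> (real^'m)) \<times> real"
    assume u: "0 < u" "u < 1"
    let ?w = "(1 - u) *\<^sub>R p + u *\<^sub>R q"
    let ?h = "\<lambda>p :: ((real^'n) \<times> (real^'m)) \<times> real. A *v fst (fst p) + snd (fst p) - b"
    have "?h ?w = (1 - u) *\<^sub>R ?h p + u *\<^sub>R ?h q"
      by (simp add: matrix_vector_right_distrib matrix_vector_mult_scaleR algebra_simps)
    also have "norm \<dots> \<le> (1 - u) * norm (?h p) + u * norm (?h q)"
      using u by (intro order_trans[OF norm_triangle_ineq]) simp
    finally show "norm (?h ?w) \<le> (1 - u) * norm (?h p) + u * norm (?h q)" .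
  qed simp
  moreover have "convex_on UNIV
      (\<lambda>p :: ((real^'n) \<times> (real^'m)) \<times> real. infdist (snd (fst p)) C)"
    using convex_onD[OF convex_on_infdist[OF C]] by (intro convex_onI) auto
  ultimately have "convex_on UNIV (\<lambda>p :: ((real^'n) \<times> (real^'m)) \<times> real.
      1/2 * (max (f (fst (fst p)) - snd p) 0)\<^sup>2 +
      1/2 * ((norm (A *v fst (fst p) + snd (fst p) - b))\<^sup>2 + (infdist (snd (fst p)) C)\<^sup>2))"
    by (intro convex_on_add convex_on_cmul convex_on_power2_of_nonneg) (auto simp: infdist_nonneg)
  then show ?thesis
    by (simp add: r_def r0_def case_prod_unfold)
qed

lemma convex_on_rstar: "convex_on UNIV (rstar f C A b)"
proof -
  have "convex_on UNIV
      (\<lambda>t. INF p. (\<lambda>((x, s), t). r f C A b x s t) (p, t))"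
    by (rule convex_on_partial_INF) (use convex_on_r bdd_below_r in \<open>simp_all add: case_prod_unfold\<close>)
  also have "(\<lambda>t. INF p. (\<lambda>((x, s), t). r f C A b x s t) (p, t)) = rstar f C A b"
    by (simp add: fun_eq_iff rstar_def case_prod_unfold)
  finally show ?thesis .
qed

lemma continuous_on_rstar: "continuous_on UNIV (rstar f C A b)"
  by (rule convex_on_continuous[OF open_UNIV convex_on_rstar])

text \<open>A finite convex function on the line is continuous, which makes its epigraph
  closed.\<close>

lemma closed_convex_proper_rstar: "closed_convex_proper (rstar f C A b)"
proof -
  have "epigraph UNIV (rstar f C A b) = {p. rstar f C A b (fst p) \<le> snd p}"
    by (auto simp: epigraph_def)
  also have "closed \<dots>"
    by (intro closed_Collect_le continuous_intros continuous_on_compose2[OF continuous_on_rstar])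
      auto
  finally show ?thesis
    by (simp add: closed_convex_proper_def convex_on_rstar proper_fun_def)
qed

lemma closed_stationary: "closed (stationary_levels f C A b)"
proof -
  have "stationary_levels f C A b = {t. rstar f C A b t = min_r0 C A b}"
    by (auto simp: stationary_iff)
  also have "closed \<dots>"
    by (intro closed_Collect_eq continuous_intros continuous_on_rstar)
  finally show ?thesis .
qed

lemma stationary_upward_closed:
  assumes "s \<in> stationary_levels f C A b" "s \<le> t"
  shows "t \<in> stationary_levels f C A b"
  using assms antimonoD[OF antimono_rstar, of s t] min_r0_le_rstar[of t] by (simp add: stationary_iff)

text \<open>A nonempty, closed and upward closed set of reals is the whole line or a closed ray; in
  the latter case the infimum is attained.\<close>

lemma tstar_cases:
  assumes "stationary_levels f C A b \<noteq> {}"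
  obtains "tstar f C A b = -\<infinity>" "stationary_levels f C A b = UNIV"
  | c where "tstar f C A b = ereal c" "stationary_levels f C A b = {c..}"
proof (cases "bdd_below (stationary_levels f C A b)")
  case True
  define c where "c = Inf (stationary_levels f C A b)"
  have "c \<in> stationary_levels f C A b"
    unfolding c_def by (rule closed_contains_Inf[OF assms True closed_stationary])
  moreover have "c \<le> t" if "t \<in> stationary_levels f C A b" for t
    unfolding c_def by (rule cInf_lower[OF that True])
  ultimately have S: "stationary_levels f C A b = {c..}"
    by (auto intro: stationary_upward_closed)
  have "tstar f C A b = ereal c"
    unfolding tstar_def S by (intro Inf_eqI) auto
  then show ?thesis
    using S by (rule that(2))
next
  case False
  have *: "\<exists>s\<in>stationary_levels f C A b. s < t" for t
    using False by (meson bdd_belowI not_le)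
  then have S: "stationary_levels f C A b = UNIV"
    by (auto intro: stationary_upward_closed less_imp_le)
  have "tstar f C A b = -\<infinity>"
    unfolding tstar_def S by (rule ereal_bot) (simp add: Inf_lower)
  then show ?thesis
    using S by (rule that(1))
qed

text \<open>Levels left of \<open>c\<close> are not stationary, so \<open>rstar\<close> lies
  strictly above its minimum there, and convexity upgrades this to strict decrease.\<close>

lemma strict_antimono_on_rstar:
  assumes "stationary_levels f C A b = {c..}"
  shows "strict_antimono_on {..c} (rstar f C A b)"
proof (rule strict_antimono_on_convex_until_min[OF convex_on_rstar])
  fix t
  assume "t < c"
  have "t \<in> stationary_levels f C A b \<longleftrightarrow> c \<le> t" "c \<in> stationary_levels f C A b"
    by (auto simp: assms)
  with \<open>t < c\<close> show "rstar f C A b c < rstar f C A b t"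
    using min_r0_le_rstar[of t] by (auto simp: stationary_iff)
qed

end

end

theorem proposition2:
  fixes f :: "real^'n \<Rightarrow> real"
    and C :: "(real^'m) set"
    and A :: "real^'n^'m"
    and b :: "real^'m"
  assumes "closed_convex_proper f"
    and "C \<noteq> {}" and "closed C" and "convex C"
  shows
    "closed_convex_proper (rstar f C A b) \<and>
     (feasible C A b \<longrightarrow>
        (tstar f C A b = -\<infinity> \<or> (\<exists>ts \<in> stationary_levels f C A b. tstar f C A b = ereal ts)) \<and>
        strict_antimono_on {t. ereal t \<le> tstar f C A b} (rstar f C A b) \<and>
        (\<forall>t. tstar f C A b \<le> ereal t \<longrightarrow> rstar f C A b t = 0)) \<and>
     (\<not> feasible C A b \<longrightarrow>
        (rstar f C A b \<longlongrightarrow> min_r0 C A b) at_top \<and>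
        (r0_attains_min C A b \<longrightarrow>
          min_r0 C A b > 0 \<and>
          (tstar f C A b \<noteq> -\<infinity> \<longrightarrow>
            (\<exists>\<tau>::real.
              (\<forall>t\<ge>\<tau>. subdifferential (rstar f C A b) t = {0} \<and> rstar f C A b t = min_r0 C A b) \<and>
              strict_antimono_on {..\<tau>} (rstar f C A b))) \<and>
          (tstar f C A b = -\<infinity> \<longrightarrow>
            (\<forall>t. subdifferential (rstar f C A b) t = {0} \<and> rstar f C A b t = min_r0 C A b)))) \<and>
     (unbounded f C A b \<longrightarrow> (\<forall>t. rstar f C A b t = 0))"
proof -
  have f: "convex_on UNIV f"
    using assms(1) by (simp add: closed_convex_proper_def)
  note C = assms(4,2)
  \<comment> \<open>Oriented so that equations \<open>rstar = min_r0\<close> become membership in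
    the stationary set, which the case split describes explicitly.\<close>
  note min_iff = stationary_iff[of _ f C A b, symmetric]
  have attained: "stationary_levels f C A b \<noteq> {}" if "r0_attains_min C A b"
    using that stationary_of_r0_minimiser[of C A b _ _ f] unfolding r0_attains_min_def by blast
  have 1: "closed_convex_proper (rstar f C A b)"
    by (rule closed_convex_proper_rstar[OF f C])
  have 2: "(tstar f C A b = -\<infinity> \<or> (\<exists>ts \<in> stationary_levels f C A b. tstar f C A b = ereal ts)) \<and>
      strict_antimono_on {t. ereal t \<le> tstar f C A b} (rstar f C A b) \<and>
      (\<forall>t. tstar f C A b \<le> ereal t \<longrightarrow> rstar f C A b t = 0)"
    if feas: "feasible C A b"
  proof -
    note zero = min_iff[unfolded min_r0_eq_0_of_feasible[OF feas]]
    show ?thesis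
    proof (cases rule: tstar_cases[OF f C attained[OF r0_attains_min_of_feasible[OF feas]]])
      \<comment> \<open>With \<open>tstar\<close> equal to \<open>-\<infinity>\<close> no real level
        lies at or below it, so strict decrease is vacuous and every level has value 0.\<close>
      case 1
      then show ?thesis
        by (simp add: zero monotone_on_def)
    next
      case (2 c)
      then show ?thesis
        using strict_antimono_on_rstar[OF f C 2(2)] by (simp add: zero atMost_def)
    qed
  qed
  have 3: "min_r0 C A b > 0 \<and>
      (tstar f C A b \<noteq> -\<infinity> \<longrightarrow>
        (\<exists>\<tau>::real.
          (\<forall>t\<ge>\<tau>. subdifferential (rstar f C A b) t = {0} \<and> rstar f C A b t = min_r0 C A b) \<and>
          strict_antimono_on {..\<tau>} (rstar f C A b))) \<and>
      (tstar f C A b = -\<infinity> \<longrightarrow>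
        (\<forall>t. subdifferential (rstar f C A b) t = {0} \<and> rstar f C A b t = min_r0 C A b))"
    if infeas: "\<not> feasible C A b" and att: "r0_attains_min C A b"
  proof -
    have pos: "min_r0 C A b > 0"
      using min_r0_pos_of_infeasible[OF infeas att] assms by simp
    have flat: "subdifferential (rstar f C A b) t = {0} \<and> rstar f C A b t = min_r0 C A b"
      if "t \<in> stationary_levels f C A b" for t
      using that subdifferential_rstar_at_min by (simp add: stationary_iff)
    show ?thesis
    proof (cases rule: tstar_cases[OF f C attained[OF att]])
      case 1
      with pos flat show ?thesis
        by simp
    next
      \<comment> \<open>The threshold \<open>\<tau>\<close> is \<open>c\<close>, the finite value of
        \<open>tstar\<close>.\<close>
      case (2 c)
      with pos flat strict_antimono_on_rstar[OF f C 2(2)] show ?thesis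
        by auto
    qed
  qed
  show ?thesis
    using 1 2 3 tendsto_rstar[of f C A b] rstar_eq_0_of_unbounded[of f C A b] by blast
qed

end
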